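(* Let $(X,\tau,\mathfrak{M},\mu)$ be a topological measure space with the property that there exists a collection $\{O_j\}_{j=1}^\infty$ of open sets satisfying $X=\bigcup_{j=1}^\infty O_j$ and $\mu(O_j)<\infty$ for all $j\in\mathbb{N}$. Then the following conditions are equivalent. (a) The measure $\mu$ is Borel regular, and every open set $U\subseteq X$ can be written as $U=F\cup Z$, where $F$ is an $F_\sigma$ set and $Z$ is a null set. (b) The measure $\mu$ is outer regular on $\mathfrak{M}$, i.e., for every measurable set $E\in\mathfrak{M}$, $\mu(E)=\inf\{\mu(O): O \text{ open},\ O\supseteq E\}$. (c) The measure $\mu$ is inner regular on $\mathfrak{M}$, i.e., for every measurable set $E\in\mathfrak{M}$, $\mu(E)=\sup\{\mu(C): C \text{ closed},\ C\subseteq E\}$.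
   Context: A topological measure space is a quadruple $(X,\tau,\mathfrak{M},\mu)$ where $(X,\tau)$ is a topological space, $\mathfrak{M}$ is a $\sigma$-algebra of subsets of $X$ containing the Borel $\sigma$-algebra $\mathrm{Borel}_\tau(X)$ (equality is not required), and $\mu:\mathfrak{M}\to[0,\infty]$ is a nonnegative measure. The measure $\mu$ is Borel regular if for every $E\in\mathfrak{M}$ there exists $B\in\mathrm{Borel}_\tau(X)$ with $E\subseteq B$ and $\mu(B)=\mu(E)$. A null set is a set $Z\in\mathfrak{M}$ with $\mu(Z)=0$; an $F_\sigma$ set is a countable union of closed sets. *)

theory Defs
  imports "HOL-Analysis.Analysis"
begin

definition borel_sets_of :: "'a topology \<Rightarrow> 'a set set" where
  "borel_sets_of T = sigma_sets (topspace T) {U. openin T U}"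

text \<open>
  The topology is an abstract one, so that the space need not be a whole type; the library's
  type-class based \<^const>\<open>borel\<close> does not apply.
\<close>

definition topological_measure_space :: "'a topology \<Rightarrow> 'a measure \<Rightarrow> bool" where
  "topological_measure_space T M \<longleftrightarrow> space M = topspace T \<and> borel_sets_of T \<subseteq> sets M"

definition borel_regular_measure :: "'a topology \<Rightarrow> 'a measure \<Rightarrow> bool" where
  "borel_regular_measure T M \<longleftrightarrow>
     (\<forall>E\<in>sets M. \<exists>B\<in>borel_sets_of T. E \<subseteq> B \<and> emeasure M B = emeasure M E)"

definition outer_regular_measure :: "'a topology \<Rightarrow> 'a measure \<Rightarrow> bool" where
  "outer_regular_measure T M \<longleftrightarrow>
     (\<forall>E\<in>sets M. emeasure M E = (INF U\<in>{U. openin T U \<and> E \<subseteq> U}. emeasure M U))"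

text \<open>
  Inner regularity is by closed sets, not by compact ones.
\<close>

definition inner_regular_measure :: "'a topology \<Rightarrow> 'a measure \<Rightarrow> bool" where
  "inner_regular_measure T M \<longleftrightarrow>
     (\<forall>E\<in>sets M. emeasure M E = (SUP C\<in>{C. closedin T C \<and> C \<subseteq> E}. emeasure M C))"

end

theory Submission
  imports Defs
begin

text \<open>
  All three conditions are equivalent to one about differences of sets rather than about values of
  the measure, which therefore remains meaningful for sets of infinite measure: every measurable
  \<open>E\<close> lies in open sets \<open>U\<close> with \<open>U - E\<close> of arbitrarily small measure
  (\<open>small_open_excess\<close>). Complementation turns it into the dual statement that \<open>E\<close> contains closed
  sets \<open>C\<close> with \<open>E - C\<close> small. From the two forms, (b) and (c) follow by additivity, and (a) follows
  by intersecting, respectively uniting, a sequence of approximations with excess tending to zero.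

  For the converse, \<open>small_open_excess\<close> is a local property
  (\<open>small_open_excess_if_locally\<close>): it suffices to treat each member \<open>W\<close> of the open cover, where
  measures are finite and may be subtracted, because the union of the open sets found inside
  the members of the cover is again open. Outer regularity is applied to \<open>E \<inter> W\<close>, inner
  regularity to \<open>W - E\<close>; a closed subset of the latter has an open complement containing \<open>E\<close>.
  Finally, under (a), the sets that can be squeezed within \<open>W\<close> between a closed and an open set
  form a \<open>\<sigma>\<close>-algebra (\<open>squeezable_Compl\<close>, \<open>squeezable_UN\<close>), to which the open sets belong
  because they are \<open>F\<^sub>\<sigma>\<close> up to a null set. Hence it contains all Borel sets, and Borel regularity
  carries the approximation from above over to all measurable sets.
\<close>

section \<open>Smallness of countable unions and decreasing intersections\<close>

lemma small_measure_UN_tolerances: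
  fixes e :: ennreal
  assumes "0 < e"
  shows "\<exists>d :: nat \<Rightarrow> ennreal. (\<forall>n. 0 < d n) \<and>
    (\<forall>A. (\<forall>n. A n \<in> sets M \<and> emeasure M (A n) < d n) \<longrightarrow> emeasure M (\<Union>n. A n) < e)"
proof -
  \<comment> \<open>Summing strict bounds only gives a weak one, so the tolerances must add up to less than \<open>e\<close>.\<close>
  obtain c where c: "0 < c" "c < e"
    using assms dense by blast
  define d where "d n = c * ennreal ((1/2) ^ Suc n)" for n :: nat
  have pos: "0 < d n" for n
    using c(1) by (simp add: d_def ennreal_zero_less_mult_iff del: power_Suc)
  have "(\<Sum>n. ennreal ((1/2) ^ Suc n)) = ennreal 1"
    by (intro suminf_ennreal_eq power_half_series) simp
  then have total: "(\<Sum>n. d n) = c"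
    unfolding d_def by (subst ennreal_suminf_cmult) simp
  have "emeasure M (\<Union>n. A n) < e"
    if A: "\<forall>n. A n \<in> sets M \<and> emeasure M (A n) < d n" for A
  proof -
    have "emeasure M (\<Union>n. A n) \<le> (\<Sum>n. emeasure M (A n))"
      using A by (intro emeasure_subadditive_countably) auto
    also have "\<dots> \<le> (\<Sum>n. d n)"
      using A by (intro suminf_le) (auto intro: less_imp_le)
    finally show ?thesis
      using total c(2) by simp
  qed
  with pos show ?thesis
    by blast
qed

lemma decseq_eventually_small_measure:
  assumes A: "\<And>n :: nat. A n \<in> sets M" and "decseq A"
    and fin: "\<And>n. emeasure M (A n) < \<infinity>"
    and "emeasure M (\<Inter>n. A n) < e"
  shows "\<exists>n. emeasure M (A n) < e"
proof -
  have "(\<lambda>n. emeasure M (A n)) \<longlonglongrightarrow> emeasure M (\<Inter>n. A n)"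
    using A fin \<open>decseq A\<close> by (intro Lim_emeasure_decseq) (auto simp: less_top)
  then have "\<forall>\<^sub>F n in sequentially. emeasure M (A n) < e"
    using assms(4) by (rule order_tendstoD(2))
  then show ?thesis
    by (auto simp: eventually_sequentially)
qed

lemma small_measure_null:
  assumes "\<And>n :: nat. emeasure M N < ennreal (1 / real (Suc n))"
  shows "emeasure M N = 0"
proof -
  have "(\<lambda>n. ennreal (1 / real (Suc n))) \<longlonglongrightarrow> ennreal 0"
    by (intro tendsto_ennrealI LIMSEQ_Suc[OF lim_1_over_n])
  then have "emeasure M N \<le> ennreal 0"
    using assms by (intro LIMSEQ_le_const) (auto intro: less_imp_le)
  then show ?thesis
    by simp
qed

lemma emeasure_eq_add_Diff:
  assumes "A \<in> sets M" "B \<in> sets M" "A \<subseteq> B"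
  shows "emeasure M B = emeasure M A + emeasure M (B - A)"
  using plus_emeasure[of A M "B - A"] assms by (simp add: Un_absorb1)

section \<open>Approximation by open sets with small excess\<close>

definition small_open_excess :: "'a topology \<Rightarrow> 'a measure \<Rightarrow> bool" where
  "small_open_excess T M \<longleftrightarrow>
     (\<forall>E\<in>sets M. \<forall>e>0. \<exists>U. openin T U \<and> E \<subseteq> U \<and> emeasure M (U - E) < e)"

locale topological_measure =
  fixes T :: "'a topology" and M :: "'a measure"
  assumes tms: "topological_measure_space T M"
begin

lemma space_eq: "space M = topspace T"
  using tms by (simp add: topological_measure_space_def)

lemma borel_measurable_set: "B \<in> borel_sets_of T \<Longrightarrow> B \<in> sets M"
  using tms by (auto simp: topological_measure_space_def)

lemma open_borel: "openin T U \<Longrightarrow> U \<in> borel_sets_of T"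
  by (simp add: borel_sets_of_def sigma_sets.Basic)

lemma open_measurable: "openin T U \<Longrightarrow> U \<in> sets M"
  by (simp add: open_borel borel_measurable_set)

lemma closed_measurable:
  assumes "closedin T C"
  shows "C \<in> sets M"
proof -
  have "space M - (topspace T - C) \<in> sets M"
    using assms by (intro sets.compl_sets open_measurable) blast
  then show ?thesis
    using closedin_subset[OF assms] by (simp add: space_eq double_diff)
qed

lemma measurable_subset_topspace: "E \<in> sets M \<Longrightarrow> E \<subseteq> topspace T"
  using sets.sets_into_space space_eq by blast

text \<open>
  The dual form: an open superset of the complement of \<open>E\<close> is the complement of a closed
  subset of \<open>E\<close>, and the two differences are the same set.
\<close>

lemma small_open_excess_closed:
  assumes "small_open_excess T M" and E: "E \<in> sets M" and "0 < e"
  obtains C where "closedin T C" "C \<subseteq> E" "emeasure M (E - C) < e"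
proof -
  have "topspace T - E \<in> sets M"
    using sets.compl_sets[OF E] space_eq by simp
  then obtain U where U: "openin T U" "topspace T - E \<subseteq> U" "emeasure M (U - (topspace T - E)) < e"
    using assms unfolding small_open_excess_def by blast
  have "E - (topspace T - U) = U - (topspace T - E)"
    using openin_subset[OF U(1)] measurable_subset_topspace[OF E] by blast
  then show ?thesis
    using U by (intro that[of "topspace T - U"]) auto
qed

section \<open>Consequences of small open excess\<close>

lemma outer_regular_if_small_open_excess:
  assumes "small_open_excess T M"
  shows "outer_regular_measure T M"
  unfolding outer_regular_measure_def
proof
  fix E assume E: "E \<in> sets M"
  let ?I = "INF U\<in>{U. openin T U \<and> E \<subseteq> U}. emeasure M U"
  have "?I \<le> emeasure M E"
  proof (rule ennreal_le_epsilon)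
    fix r :: real assume "0 < r"
    have "0 < ennreal r"
      using \<open>0 < r\<close> by simp
    then obtain U where U: "openin T U" "E \<subseteq> U" "emeasure M (U - E) < ennreal r"
      using assms E unfolding small_open_excess_def by blast
    have "?I \<le> emeasure M U"
      using U by (intro INF_lower) auto
    also have "\<dots> = emeasure M E + emeasure M (U - E)"
      by (rule emeasure_eq_add_Diff[OF E open_measurable[OF U(1)] U(2)])
    also have "\<dots> \<le> emeasure M E + ennreal r"
      using U(3) by (intro add_left_mono) simp
    finally show "?I \<le> emeasure M E + ennreal r" .
  qed
  moreover have "emeasure M E \<le> ?I"
    by (intro INF_greatest emeasure_mono) (auto intro: open_measurable)
  ultimately show "emeasure M E = ?I"
    by (intro antisym)
qed

lemma inner_regular_if_small_open_excess:
  assumes "small_open_excess T M"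
  shows "inner_regular_measure T M"
  unfolding inner_regular_measure_def
proof
  fix E assume E: "E \<in> sets M"
  let ?S = "SUP C\<in>{C. closedin T C \<and> C \<subseteq> E}. emeasure M C"
  have "emeasure M E \<le> ?S"
  proof (rule ennreal_le_epsilon)
    fix r :: real assume "0 < r"
    have "0 < ennreal r"
      using \<open>0 < r\<close> by simp
    then obtain C where C: "closedin T C" "C \<subseteq> E" "emeasure M (E - C) < ennreal r"
      by (rule small_open_excess_closed[OF assms E])
    have "emeasure M E = emeasure M C + emeasure M (E - C)"
      by (rule emeasure_eq_add_Diff[OF closed_measurable[OF C(1)] E C(2)])
    also have "\<dots> \<le> ?S + ennreal r"
      using C by (intro add_mono SUP_upper) auto
    finally show "emeasure M E \<le> ?S + ennreal r" .
  qed
  moreover have "?S \<le> emeasure M E"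
    using E by (intro SUP_least emeasure_mono) auto
  ultimately show "emeasure M E = ?S"
    by (rule antisym)
qed

lemma borel_regular_if_small_open_excess:
  assumes "small_open_excess T M"
  shows "borel_regular_measure T M"
  unfolding borel_regular_measure_def
proof
  fix E assume E: "E \<in> sets M"
  have "\<exists>U. openin T U \<and> E \<subseteq> U \<and> emeasure M (U - E) < ennreal (1 / real (Suc n))" for n
    using assms E unfolding small_open_excess_def by simp
  then obtain U where U: "\<And>n. openin T (U n)" "\<And>n. E \<subseteq> U n"
      "\<And>n. emeasure M (U n - E) < ennreal (1 / real (Suc n))"
    by metis
  define B where "B = (\<Inter>n. U n)"
  have "B \<in> borel_sets_of T"
    unfolding B_def borel_sets_of_def
    using U(1) openin_subset by (intro sigma_sets_Inter) (auto intro: sigma_sets.Basic)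
  moreover have "E \<subseteq> B"
    using U(2) by (auto simp: B_def)
  moreover have "emeasure M B = emeasure M E"
  proof -
    have B: "B \<in> sets M"
      using \<open>B \<in> borel_sets_of T\<close> by (rule borel_measurable_set)
    have "emeasure M (B - E) < ennreal (1 / real (Suc n))" for n
    proof -
      have "emeasure M (B - E) \<le> emeasure M (U n - E)"
        by (intro emeasure_mono sets.Diff E open_measurable[OF U(1)]) (auto simp: B_def)
      also note U(3)
      finally show ?thesis .
    qed
    then have "emeasure M (B - E) = 0"
      by (rule small_measure_null)
    then show ?thesis
      using emeasure_eq_add_Diff[OF E B \<open>E \<subseteq> B\<close>] by simp
  qed
  ultimately show "\<exists>B\<in>borel_sets_of T. E \<subseteq> B \<and> emeasure M B = emeasure M E"
    by blast
qed

lemma open_fsigma_null_if_small_open_excess: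
  assumes "small_open_excess T M" and U: "openin T U"
  shows "\<exists>F Z. fsigma_in T F \<and> Z \<in> null_sets M \<and> U = F \<union> Z"
proof -
  have "\<exists>C. closedin T C \<and> C \<subseteq> U \<and> emeasure M (U - C) < ennreal (1 / real (Suc n))" for n
    by (rule small_open_excess_closed[OF assms(1) open_measurable[OF U]]) auto
  then obtain C where C: "\<And>n. closedin T (C n)" "\<And>n. C n \<subseteq> U"
      "\<And>n. emeasure M (U - C n) < ennreal (1 / real (Suc n))"
    by metis
  define F where "F = (\<Union>n. C n)"
  have F: "F \<in> sets M"
    unfolding F_def using C(1) closed_measurable by blast
  have "emeasure M (U - F) < ennreal (1 / real (Suc n))" for n
  proof -
    have "emeasure M (U - F) \<le> emeasure M (U - C n)"
      using U C(1) by (intro emeasure_mono sets.Diff open_measurable closed_measurable)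
        (auto simp: F_def)
    also note C(3)
    finally show ?thesis .
  qed
  then have "U - F \<in> null_sets M"
    using F U by (auto simp: null_sets_def open_measurable small_measure_null)
  moreover have "fsigma_in T F"
    unfolding F_def by (intro fsigma_in_Union) (auto intro: closed_imp_fsigma_in C(1))
  moreover have "U = F \<union> (U - F)"
    using C(2) by (auto simp: F_def)
  ultimately show ?thesis
    by blast
qed

section \<open>Localization to an open cover\<close>

text \<open>
  The open set chosen for \<open>W j\<close> may have large excess outside \<open>W j\<close>, so it is cut down to \<open>W j\<close>
  before the union is taken; the tolerances for the single \<open>j\<close> are chosen so that
  the excesses add up to less than \<open>e\<close>.
\<close>

lemma small_open_excess_if_locally:
  fixes W :: "nat \<Rightarrow> 'a set"
  assumes W: "\<And>j. openin T (W j)" "topspace T = (\<Union>j. W j)"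
    and local: "\<And>E j e. \<lbrakk>E \<in> sets M; 0 < e\<rbrakk>
      \<Longrightarrow> \<exists>U. openin T U \<and> E \<inter> W j \<subseteq> U \<and> emeasure M (W j \<inter> U - E) < e"
  shows "small_open_excess T M"
  unfolding small_open_excess_def
proof (intro ballI allI impI)
  fix E and e :: ennreal assume E: "E \<in> sets M" and "0 < e"
  obtain d :: "nat \<Rightarrow> ennreal" where d: "\<And>n. 0 < d n"
    and small: "\<forall>A. (\<forall>n. A n \<in> sets M \<and> emeasure M (A n) < d n) \<longrightarrow> emeasure M (\<Union>n. A n) < e"
    using small_measure_UN_tolerances[OF \<open>0 < e\<close>] by metis
  have "\<exists>U. openin T U \<and> E \<inter> W j \<subseteq> U \<and> emeasure M (W j \<inter> U - E) < d j" for j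
    by (rule local[OF E d])
  then obtain U where U: "\<And>j. openin T (U j)" "\<And>j. E \<inter> W j \<subseteq> U j"
      "\<And>j. emeasure M (W j \<inter> U j - E) < d j"
    by metis
  have "openin T (\<Union>j. W j \<inter> U j)"
    using W(1) U(1) by (intro openin_Union) auto
  moreover have "E \<subseteq> (\<Union>j. W j \<inter> U j)"
  proof
    fix x assume "x \<in> E"
    then obtain j where "x \<in> W j"
      using measurable_subset_topspace[OF E] W(2) by auto
    then show "x \<in> (\<Union>j. W j \<inter> U j)"
      using \<open>x \<in> E\<close> U(2)[of j] by auto
  qed
  moreover have "emeasure M (\<Union>j. W j \<inter> U j - E) < e"
    by (intro small[rule_format] conjI sets.Diff sets.Int E open_measurable W(1) U)
  moreover have "(\<Union>j. W j \<inter> U j - E) = (\<Union>j. W j \<inter> U j) - E"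
    by blast
  ultimately show "\<exists>U. openin T U \<and> E \<subseteq> U \<and> emeasure M (U - E) < e"
    by metis
qed

text \<open>
  An infimum equal to \<open>\<infinity>\<close> says nothing about excess; intersecting with \<open>W\<close> makes it finite, so
  that it is nearly attained and the difference of measures is the measure of the difference.
\<close>

lemma local_excess_if_outer_regular:
  assumes "outer_regular_measure T M" and W: "openin T W" and fin: "emeasure M W < \<infinity>"
    and E: "E \<in> sets M" and "0 < e"
  shows "\<exists>U. openin T U \<and> E \<inter> W \<subseteq> U \<and> emeasure M (W \<inter> U - E) < e"
proof -
  have EW: "E \<inter> W \<in> sets M"
    using E W open_measurable by blast
  have "emeasure M (E \<inter> W) \<le> emeasure M W"
    using W by (auto intro: emeasure_mono open_measurable)
  then have fin': "emeasure M (E \<inter> W) \<noteq> \<infinity>"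
    using fin by (auto simp: top_unique)
  then have "emeasure M (E \<inter> W) < emeasure M (E \<inter> W) + e"
    using \<open>0 < e\<close> ennreal_add_left_cancel_less[of "emeasure M (E \<inter> W)" 0 e] by simp
  moreover have "emeasure M (E \<inter> W) = (INF U\<in>{U. openin T U \<and> E \<inter> W \<subseteq> U}. emeasure M U)"
    using assms(1) EW unfolding outer_regular_measure_def by blast
  ultimately have "(INF U\<in>{U. openin T U \<and> E \<inter> W \<subseteq> U}. emeasure M U) < emeasure M (E \<inter> W) + e"
    by simp
  then obtain U where U: "openin T U" "E \<inter> W \<subseteq> U" "emeasure M U < emeasure M (E \<inter> W) + e"
    by (auto simp: INF_less_iff)
  have "emeasure M U = emeasure M (E \<inter> W) + emeasure M (U - E \<inter> W)"
    by (rule emeasure_eq_add_Diff[OF EW open_measurable[OF U(1)] U(2)])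
  then have "emeasure M (U - E \<inter> W) < e"
    using U(3) by (metis ennreal_add_left_cancel_less)
  moreover have "emeasure M (W \<inter> U - E) \<le> emeasure M (U - E \<inter> W)"
    using W by (intro emeasure_mono sets.Diff EW open_measurable[OF U(1)]) auto
  ultimately show ?thesis
    using U by (meson le_less_trans)
qed

text \<open>
  Closed subsets of \<open>E \<inter> W\<close> would not help, since their union over a cover need not be closed. A
  nearly exhausting closed subset \<open>C\<close> of \<open>W - E\<close> does: its complement is open and exceeds \<open>E\<close>
  within \<open>W\<close> only by \<open>W - E - C\<close>.
\<close>

lemma local_excess_if_inner_regular:
  assumes "inner_regular_measure T M" and W: "openin T W" and fin: "emeasure M W < \<infinity>"
    and E: "E \<in> sets M" and "0 < e"
  shows "\<exists>U. openin T U \<and> E \<inter> W \<subseteq> U \<and> emeasure M (W \<inter> U - E) < e"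
proof -
  have WE: "W - E \<in> sets M"
    using E W open_measurable by blast
  have "emeasure M (W - E) \<le> emeasure M W"
    using W by (auto intro: emeasure_mono open_measurable)
  then have fin': "emeasure M (W - E) < \<infinity>"
    using fin by simp
  obtain C where C: "closedin T C" "C \<subseteq> W - E" "emeasure M (W - E) < emeasure M C + e"
    \<comment> \<open>Subtraction of \<open>e\<close> truncates at zero, whence the case distinction.\<close>
  proof (cases "emeasure M (W - E) < e")
    case True
    then show ?thesis
      using that[of "{}"] by simp
  next
    case False
    then have "e \<le> emeasure M (W - E)"
      by simp
    then have "e < top" "0 < emeasure M (W - E)"
      using \<open>0 < e\<close> fin' by auto
    then have "emeasure M (W - E) - e < emeasure M (W - E)"
      using fin' \<open>0 < e\<close> by (intro ennreal_between) auto
    also have "\<dots> = (SUP C\<in>{C. closedin T C \<and> C \<subseteq> W - E}. emeasure M C)"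
      using assms(1) WE unfolding inner_regular_measure_def by blast
    finally obtain C where "closedin T C" "C \<subseteq> W - E" "emeasure M (W - E) - e < emeasure M C"
      by (auto simp: less_SUP_iff)
    then show ?thesis
      using that minus_less_iff_ennreal[OF \<open>e < top\<close> \<open>e \<le> emeasure M (W - E)\<close>] by blast
  qed
  have "emeasure M (W - E) = emeasure M C + emeasure M (W - E - C)"
    by (rule emeasure_eq_add_Diff[OF closed_measurable[OF C(1)] WE C(2)])
  then have small: "emeasure M (W - E - C) < e"
    using C(3) by (metis ennreal_add_left_cancel_less)
  have "W \<inter> (topspace T - C) - E = W - E - C"
    using openin_subset[OF W] by blast
  then show ?thesis
    using C small measurable_subset_topspace[OF E] by (intro exI[of _ "topspace T - C"]) auto
qed

section \<open>Squeezing Borel sets between closed and open sets\<close>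

text \<open>
  Small excess from outside is not stable under complements and small defect from inside is not
  either, so the two are demanded together; within a set \<open>W\<close> of finite measure the combination
  is also stable under countable unions.
\<close>

definition squeezable :: "'a set \<Rightarrow> 'a set \<Rightarrow> bool" where
  "squeezable W E \<longleftrightarrow> (\<forall>e>0. \<exists>C U. closedin T C \<and> openin T U \<and> C \<subseteq> E \<and> E \<subseteq> U \<and>
     emeasure M (W \<inter> (U - C)) < e)"

lemma squeezableE:
  assumes "squeezable W E" and "0 < e"
  obtains C U where "closedin T C" "openin T U" "C \<subseteq> E" "E \<subseteq> U" "emeasure M (W \<inter> (U - C)) < e"
  using assms(1)[unfolded squeezable_def, rule_format, OF assms(2)]
  by (elim exE conjE) (rule that)

lemma squeezable_Compl:
  assumes "squeezable W E"
  shows "squeezable W (topspace T - E)"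
  unfolding squeezable_def
proof (intro allI impI)
  fix e :: ennreal assume "0 < e"
  then obtain C U where *: "closedin T C" "openin T U" "C \<subseteq> E" "E \<subseteq> U"
      "emeasure M (W \<inter> (U - C)) < e"
    by (rule squeezableE[OF assms])
  have "(topspace T - C) - (topspace T - U) = U - C"
    using openin_subset[OF *(2)] by blast
  then have "emeasure M (W \<inter> ((topspace T - C) - (topspace T - U))) < e"
    using *(5) by simp
  moreover have "topspace T - U \<subseteq> topspace T - E" "topspace T - E \<subseteq> topspace T - C"
    using *(3,4) by auto
  moreover have "closedin T (topspace T - U)" "openin T (topspace T - C)"
    using *(1,2) by auto
  ultimately show "\<exists>C U. closedin T C \<and> openin T U \<and> C \<subseteq> topspace T - E \<and> topspace T - E \<subseteq> U \<and>
     emeasure M (W \<inter> (U - C)) < e"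
    by (intro exI[of _ "topspace T - U"] exI[of _ "topspace T - C"] conjI)
qed

text \<open>
  A countable union of closed sets need not be closed, but in a set of finite measure a finite
  subunion leaves out arbitrarily little more.
\<close>

lemma finite_closed_subunion:
  fixes C :: "nat \<Rightarrow> 'a set"
  assumes W: "W \<in> sets M" "emeasure M W < \<infinity>" and U: "openin T U"
    and C: "\<And>n. closedin T (C n)" and small: "emeasure M (W \<inter> (U - (\<Union>n. C n))) < e"
  obtains D where "closedin T D" "D \<subseteq> (\<Union>n. C n)" "emeasure M (W \<inter> (U - D)) < e"
proof -
  define A where "A n = W \<inter> (U - (\<Union>k\<le>n. C k))" for n
  have closed: "closedin T (\<Union>k\<le>n. C k)" for n
    using C by (intro closedin_Union) auto
  have A: "A n \<in> sets M" for n
    unfolding A_def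
    by (intro sets.Int sets.Diff W(1) open_measurable[OF U] closed_measurable[OF closed])
  have "emeasure M (A n) \<le> emeasure M W" for n
    using W(1) by (intro emeasure_mono) (auto simp: A_def)
  then have fin: "emeasure M (A n) < \<infinity>" for n
    using W(2) le_less_trans by blast
  have "decseq A"
    unfolding decseq_def
  proof (intro allI impI)
    fix m n :: nat assume "m \<le> n"
    then have "(\<Union>k\<le>m. C k) \<subseteq> (\<Union>k\<le>n. C k)"
      by (intro UN_mono) auto
    then show "A n \<subseteq> A m"
      unfolding A_def by blast
  qed
  moreover have "(\<Inter>n. A n) = W \<inter> (U - (\<Union>n. C n))"
    by (auto simp: A_def)
  then have "emeasure M (\<Inter>n. A n) < e"
    using small by simp
  ultimately have "\<exists>n. emeasure M (A n) < e"
    by (intro decseq_eventually_small_measure A fin)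
  then obtain n where "emeasure M (A n) < e" ..
  then show ?thesis
    using closed[of n] by (intro that[of "\<Union>k\<le>n. C k"]) (auto simp: A_def)
qed

lemma squeezable_UN:
  fixes E :: "nat \<Rightarrow> 'a set"
  assumes W: "W \<in> sets M" "emeasure M W < \<infinity>" and E: "\<And>n. squeezable W (E n)"
  shows "squeezable W (\<Union>n. E n)"
  unfolding squeezable_def
proof (intro allI impI)
  fix e :: ennreal assume "0 < e"
  obtain d :: "nat \<Rightarrow> ennreal" where d: "\<And>n. 0 < d n"
    and small: "\<forall>A. (\<forall>n. A n \<in> sets M \<and> emeasure M (A n) < d n) \<longrightarrow> emeasure M (\<Union>n. A n) < e"
    using small_measure_UN_tolerances[OF \<open>0 < e\<close>] by metis
  have "\<exists>C U. closedin T C \<and> openin T U \<and> C \<subseteq> E n \<and> E n \<subseteq> U \<and>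
     emeasure M (W \<inter> (U - C)) < d n" for n
    by (rule E[unfolded squeezable_def, rule_format, OF d])
  then obtain C U where *: "\<And>n. closedin T (C n)" "\<And>n. openin T (U n)"
      "\<And>n. C n \<subseteq> E n" "\<And>n. E n \<subseteq> U n" "\<And>n. emeasure M (W \<inter> (U n - C n)) < d n"
    by metis
  have pieces: "W \<inter> (U n - C n) \<in> sets M" for n
    by (intro sets.Int sets.Diff W(1) open_measurable[OF *(2)] closed_measurable[OF *(1)])
  have open_UN: "openin T (\<Union>n. U n)"
    using *(2) by (intro openin_Union) auto
  have "emeasure M (W \<inter> ((\<Union>n. U n) - (\<Union>n. C n))) \<le> emeasure M (\<Union>n. W \<inter> (U n - C n))"
    by (intro emeasure_mono sets.countable_UN) (use pieces in auto)
  also have "\<dots> < e"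
    using pieces * by (intro small[rule_format] conjI)
  finally obtain D where D: "closedin T D" "D \<subseteq> (\<Union>n. C n)" "emeasure M (W \<inter> ((\<Union>n. U n) - D)) < e"
    by (rule finite_closed_subunion[OF W open_UN *(1)])
  show "\<exists>C U. closedin T C \<and> openin T U \<and> C \<subseteq> (\<Union>n. E n) \<and> (\<Union>n. E n) \<subseteq> U \<and>
     emeasure M (W \<inter> (U - C)) < e"
  proof (intro exI conjI)
    show "D \<subseteq> (\<Union>n. E n)"
      using D(2) *(3) by blast
    show "(\<Union>n. E n) \<subseteq> (\<Union>n. U n)"
      using *(4) by (intro UN_mono) auto
  qed (fact D open_UN)+
qed

lemma squeezable_open:
  assumes W: "W \<in> sets M" "emeasure M W < \<infinity>"
    and U: "openin T U" and F: "fsigma_in T F" and Z: "Z \<in> null_sets M" and eq: "U = F \<union> Z"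
  shows "squeezable W U"
  unfolding squeezable_def
proof (intro allI impI)
  fix e :: ennreal assume "0 < e"
  obtain C :: "nat \<Rightarrow> 'a set" where C: "\<And>n. closedin T (C n)" "(\<Union>n. C n) = F"
    using F by (auto simp: fsigma_in_ascending)
  have "emeasure M (W \<inter> (U - F)) \<le> emeasure M Z"
    using Z eq by (intro emeasure_mono) auto
  also have "\<dots> < e"
    using Z \<open>0 < e\<close> by (simp add: null_setsD1)
  finally have "emeasure M (W \<inter> (U - (\<Union>n. C n))) < e"
    using C(2) by simp
  then obtain D where D: "closedin T D" "D \<subseteq> (\<Union>n. C n)" "emeasure M (W \<inter> (U - D)) < e"
    by (rule finite_closed_subunion[OF W U C(1)])
  have "D \<subseteq> U"
    using D(2) C(2) eq by auto
  then show "\<exists>C V. closedin T C \<and> openin T V \<and> C \<subseteq> U \<and> U \<subseteq> V \<and> emeasure M (W \<inter> (V - C)) < e"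
    using U D(1,3) by (intro exI[of _ D] exI[of _ U] conjI) auto
qed

lemma squeezable_borel:
  assumes W: "W \<in> sets M" "emeasure M W < \<infinity>"
    and open_sets: "\<And>U. openin T U \<Longrightarrow> \<exists>F Z. fsigma_in T F \<and> Z \<in> null_sets M \<and> U = F \<union> Z"
    and "B \<in> borel_sets_of T"
  shows "squeezable W B"
  using assms(4) unfolding borel_sets_of_def
proof (induction rule: sigma_sets.induct)
  case (Basic U)
  then show ?case
    using squeezable_open[OF W] open_sets[of U] by blast
next
  case Empty
  show ?case
    unfolding squeezable_def by (intro allI impI exI[of _ "{}"]) simp
next
  case (Compl E)
  then show ?case
    by (intro squeezable_Compl)
next
  case (Union E)
  then show ?case
    by (intro squeezable_UN[OF W])
qed

text \<open>
  Borel regularity is applied to \<open>E \<inter> W\<close>, not to \<open>E\<close>: only for a set of finite measure does a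
  superset of equal measure differ by a null set.
\<close>

lemma local_excess_if_borel_regular:
  assumes "borel_regular_measure T M"
    and open_sets: "\<And>U. openin T U \<Longrightarrow> \<exists>F Z. fsigma_in T F \<and> Z \<in> null_sets M \<and> U = F \<union> Z"
    and W: "openin T W" and fin: "emeasure M W < \<infinity>"
    and E: "E \<in> sets M" and "0 < e"
  shows "\<exists>U. openin T U \<and> E \<inter> W \<subseteq> U \<and> emeasure M (W \<inter> U - E) < e"
proof -
  have EW: "E \<inter> W \<in> sets M"
    using E W open_measurable by blast
  have "emeasure M (E \<inter> W) \<le> emeasure M W"
    using W by (auto intro: emeasure_mono open_measurable)
  then have fin': "emeasure M (E \<inter> W) \<noteq> \<infinity>"
    using fin by (auto simp: top_unique)
  obtain B where B: "B \<in> borel_sets_of T" "E \<inter> W \<subseteq> B" "emeasure M B = emeasure M (E \<inter> W)"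
    using assms(1) EW unfolding borel_regular_measure_def by blast
  have BM: "B \<in> sets M"
    using B(1) by (rule borel_measurable_set)
  have null: "B - E \<inter> W \<in> null_sets M"
    using emeasure_Diff[OF fin' BM EW B(2)] B(3) BM EW fin' by (auto intro!: null_setsI)
  obtain C U where U: "closedin T C" "openin T U" "C \<subseteq> B" "B \<subseteq> U" "emeasure M (W \<inter> (U - C)) < e"
    using squeezable_borel[OF open_measurable[OF W] fin open_sets B(1)] \<open>0 < e\<close>
    by (rule squeezableE)
  have piece: "W \<inter> (U - C) \<in> sets M"
    by (intro sets.Int sets.Diff open_measurable[OF W] open_measurable[OF U(2)]
        closed_measurable[OF U(1)])
  have "emeasure M (W \<inter> U - E) \<le> emeasure M (W \<inter> (U - C) \<union> (B - E \<inter> W))"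
    using piece BM EW U by (intro emeasure_mono) auto
  also have "\<dots> = emeasure M (W \<inter> (U - C))"
    using piece null by (rule emeasure_Un_null_set)
  also have "\<dots> < e"
    by (rule U)
  finally have "emeasure M (W \<inter> U - E) < e" .
  moreover have "E \<inter> W \<subseteq> U"
    using B(2) U(4) by auto
  ultimately show ?thesis
    using U(2) by (intro exI[of _ U] conjI)
qed

end

section \<open>The equivalence\<close>

theorem theorem2p1:
  fixes T :: "'a topology" and M :: "'a measure"
  assumes "topological_measure_space T M"
    and "\<exists>W :: nat \<Rightarrow> 'a set.
           (\<forall>j. openin T (W j)) \<and> topspace T = (\<Union>j. W j) \<and> (\<forall>j. emeasure M (W j) < \<infinity>)"
  shows "((borel_regular_measure T M \<and>
           (\<forall>U. openin T U \<longrightarrow> (\<exists>F Z. fsigma_in T F \<and> Z \<in> null_sets M \<and> U = F \<union> Z)))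
          \<longleftrightarrow> outer_regular_measure T M) \<and>
         (outer_regular_measure T M \<longleftrightarrow> inner_regular_measure T M)"
proof -
  interpret topological_measure T M
    by unfold_locales (rule assms(1))
  obtain W :: "nat \<Rightarrow> 'a set" where W: "\<And>j. openin T (W j)" "topspace T = (\<Union>j. W j)"
    and fin: "\<And>j. emeasure M (W j) < \<infinity>"
    using assms(2) by blast
  note globalize = small_open_excess_if_locally[OF W]
  let ?a = "borel_regular_measure T M \<and>
           (\<forall>U. openin T U \<longrightarrow> (\<exists>F Z. fsigma_in T F \<and> Z \<in> null_sets M \<and> U = F \<union> Z))"
  have "?a \<longleftrightarrow> small_open_excess T M"
  proof
    assume a: ?a
    then have open_sets:
      "\<And>U. openin T U \<Longrightarrow> \<exists>F Z. fsigma_in T F \<and> Z \<in> null_sets M \<and> U = F \<union> Z"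
      by blast
    show "small_open_excess T M"
      by (rule globalize[OF local_excess_if_borel_regular[OF conjunct1[OF a] open_sets W(1) fin]])
  next
    assume "small_open_excess T M"
    then show ?a
      using borel_regular_if_small_open_excess open_fsigma_null_if_small_open_excess by simp
  qed
  moreover have "outer_regular_measure T M \<longleftrightarrow> small_open_excess T M"
  proof
    assume "outer_regular_measure T M"
    then show "small_open_excess T M"
      by (rule globalize[OF local_excess_if_outer_regular[OF _ W(1) fin]])
  qed (rule outer_regular_if_small_open_excess)
  moreover have "inner_regular_measure T M \<longleftrightarrow> small_open_excess T M"
  proof
    assume "inner_regular_measure T M"
    then show "small_open_excess T M"
      by (rule globalize[OF local_excess_if_inner_regular[OF _ W(1) fin]])
  qed (rule inner_regular_if_small_open_excess)
  ultimately show ?thesis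
    by (simp only:)
qed

end
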